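(* Let $H:[0,\infty)\to\mathbb R$ be a measurable function. The risk measure $R_H(X)$ is nondecreasing in $X$ with respect to the stochastic dominance of order $1$ (that is, $R_H(X)\le R_H(Y)$ for all random variables $X$, $Y$ such that $\mathsf P(X>t)\le\mathsf P(Y>t)$ for all $t\in\mathbb R$ and $R_H(X)$, $R_H(Y)$ are defined) if and only if the function $H$ is $\frac12$-Lipschitz: $|H(x)-H(y)|\le\frac12|x-y|$ for all $x$ and $y$ in $[0,\infty)$.
   Context: For a real-valued random variable $X$, $$R_H(X):=\mathsf E X+\mathsf E H(|X-\tilde X|),$$ where $\tilde X$ is an independent copy of $X$. $R_H(X)$ is defined when both expected values on the right are defined (possibly infinite) and are not infinite values of opposite signs. $R_H(X)$ depends only on the distribution of $X$; random variables with arbitrary distributions on $\mathbb R$ are considered. It is not assumed that $H\ge0$ or $H(0)=0$. *)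

theory Defs
  imports "HOL-Probability.Probability"
begin

text \<open>
  Expected values in the extended sense: \<open>E f = E f\<^sup>+ - E f\<^sup>-\<close>, which is defined
  (possibly infinite) unless both parts have infinite expectation.  Note that
  \<^const>\<open>ennreal\<close> truncates negative reals to \<open>0\<close>, and that the value of \<open>ext_expectation\<close>
  is meaningful only if \<open>ext_expectation_defined\<close> holds.
\<close>

definition ext_expectation_defined :: "'a measure \<Rightarrow> ('a \<Rightarrow> real) \<Rightarrow> bool" where
  "ext_expectation_defined M f \<longleftrightarrow>
     f \<in> borel_measurable M \<and>
     ((\<integral>\<^sup>+ \<omega>. ennreal (f \<omega>) \<partial>M) < \<infinity> \<or> (\<integral>\<^sup>+ \<omega>. ennreal (- f \<omega>) \<partial>M) < \<infinity>)"

definition ext_expectation :: "'a measure \<Rightarrow> ('a \<Rightarrow> real) \<Rightarrow> ereal" where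
  "ext_expectation M f =
     enn2ereal (\<integral>\<^sup>+ \<omega>. ennreal (f \<omega>) \<partial>M) - enn2ereal (\<integral>\<^sup>+ \<omega>. ennreal (- f \<omega>) \<partial>M)"

text \<open>
  \<open>R\<^sub>H(X) = E X + E H(|X - X'|)\<close> for a random variable \<open>X\<close> on the probability space \<open>M\<close>.
  The variable and its independent copy \<open>X'\<close> are realised on \<open>M \<Otimes>\<^sub>M M\<close> as \<open>X\<close> applied to the
  first and to the second coordinate.  Only the values of \<open>H\<close> on \<open>[0,\<infinity>)\<close> matter.
\<close>

definition spread :: "(real \<Rightarrow> real) \<Rightarrow> ('a \<Rightarrow> real) \<Rightarrow> 'a \<times> 'a \<Rightarrow> real" where
  "spread H X = (\<lambda>(\<omega>, \<omega>'). H \<bar>X \<omega> - X \<omega>'\<bar>)"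

definition R_defined :: "(real \<Rightarrow> real) \<Rightarrow> 'a measure \<Rightarrow> ('a \<Rightarrow> real) \<Rightarrow> bool" where
  "R_defined H M X \<longleftrightarrow>
     ext_expectation_defined M X \<and>
     ext_expectation_defined (M \<Otimes>\<^sub>M M) (spread H X) \<and>
     \<not> (ext_expectation M X = \<infinity> \<and> ext_expectation (M \<Otimes>\<^sub>M M) (spread H X) = - \<infinity>) \<and>
     \<not> (ext_expectation M X = - \<infinity> \<and> ext_expectation (M \<Otimes>\<^sub>M M) (spread H X) = \<infinity>)"

definition R :: "(real \<Rightarrow> real) \<Rightarrow> 'a measure \<Rightarrow> ('a \<Rightarrow> real) \<Rightarrow> ereal" where
  "R H M X = ext_expectation M X + ext_expectation (M \<Otimes>\<^sub>M M) (spread H X)"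

definition stoch_dom1 ::
    "'a measure \<Rightarrow> ('a \<Rightarrow> real) \<Rightarrow> 'b measure \<Rightarrow> ('b \<Rightarrow> real) \<Rightarrow> bool" where
  "stoch_dom1 M X N Y \<longleftrightarrow> (\<forall>t. \<P>(\<omega> in M. X \<omega> > t) \<le> \<P>(\<omega> in N. Y \<omega> > t))"

text \<open>
  Monotonicity of \<open>R\<^sub>H\<close> over all random variables \<open>X\<close>, \<open>Y\<close>, each on a probability space of its
  own.  Types cannot be quantified over inside a formula, so the types of the sample spaces are
  parameters.
\<close>

definition R_nondecreasing :: "'a itself \<Rightarrow> 'b itself \<Rightarrow> (real \<Rightarrow> real) \<Rightarrow> bool" where
  "R_nondecreasing _ _ H \<longleftrightarrow>
     (\<forall>(M :: 'a measure) (N :: 'b measure) X Y.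
        prob_space M \<longrightarrow> prob_space N \<longrightarrow>
        X \<in> borel_measurable M \<longrightarrow> Y \<in> borel_measurable N \<longrightarrow>
        stoch_dom1 M X N Y \<longrightarrow> R_defined H M X \<longrightarrow> R_defined H N Y \<longrightarrow>
        R H M X \<le> R H N Y)"

text \<open>
  Every distribution on \<open>\<real>\<close> is the law of a random variable on a sample space of type
  \<^typ>\<open>real\<close>, so \<open>R_nondecreasing TYPE(real) TYPE(real) H\<close> covers all pairs of distributions.
  In the theorem the equivalence is stated with these types, and the implication from the
  Lipschitz condition to monotonicity additionally for arbitrary types \<open>'a\<close>, \<open>'b\<close>.  As \<open>'a\<close>
  and \<open>'b\<close> are universally quantified, this says exactly that monotonicity over all random
  variables on all probability spaces is equivalent to the Lipschitz condition.
\<close>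

end

theory Submission imports Defs begin

text \<open>
  If \<open>H\<close> is \<open>1/2\<close>-Lipschitz, the quantile coupling lets us assume \<open>X \<le> Y\<close> on a common space.
  For integrable variables, integrate
  \<open>H\<bar>X - X'\<bar> - H\<bar>Y - Y'\<bar> \<le> ((Y - X) + (Y' - X')) / 2\<close>; otherwise \<open>E X = - \<infinity>\<close> or
  \<open>E Y = \<infinity>\<close>, and the inequality is trivial.  Conversely, if \<open>X\<close> is \<open>a\<close> with
  probability \<open>p\<close> and \<open>0\<close> otherwise, then
  \<open>R\<^sub>H(X) = p a + H(0) + 2 p (1 - p) (H\<bar>a\<bar> - H(0))\<close>.  Monotonicity in \<open>a\<close>, on the two half lines
  separately, gives the two halves of the Lipschitz condition after division by \<open>p\<close> and
  \<open>p \<rightarrow> 0\<close>.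
\<close>

section \<open>Extended expectations and reduction of the risk measure to laws\<close>

lemma ext_expectation_integrable:
  assumes "integrable M f"
  shows "ext_expectation_defined M f" and "ext_expectation M f = ereal (\<integral>x. f x \<partial>M)"
proof -
  from assms have f: "f \<in> borel_measurable M"
    and p: "(\<integral>\<^sup>+ x. ennreal (f x) \<partial>M) \<noteq> \<infinity>" and n: "(\<integral>\<^sup>+ x. ennreal (- f x) \<partial>M) \<noteq> \<infinity>"
    unfolding real_integrable_def by auto
  show "ext_expectation_defined M f"
    using f p unfolding ext_expectation_defined_def by (auto simp: less_top)
  show "ext_expectation M f = ereal (\<integral>x. f x \<partial>M)"
    unfolding ext_expectation_def real_lebesgue_integral_def[OF assms]
    using p n
    by (cases "\<integral>\<^sup>+ x. ennreal (f x) \<partial>M"; cases "\<integral>\<^sup>+ x. ennreal (- f x) \<partial>M") auto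
qed

lemma ext_expectation_distr:
  assumes T: "T \<in> measurable M N" and g: "g \<in> borel_measurable N"
  shows "ext_expectation_defined M (\<lambda>x. g (T x)) \<longleftrightarrow> ext_expectation_defined (distr M N T) g"
    and "ext_expectation M (\<lambda>x. g (T x)) = ext_expectation (distr M N T) g"
proof -
  have "(\<lambda>x. g (T x)) \<in> borel_measurable M" "g \<in> borel_measurable (distr M N T)"
    using assms by measurable
  then show "ext_expectation_defined M (\<lambda>x. g (T x)) \<longleftrightarrow> ext_expectation_defined (distr M N T) g"
    using assms by (simp add: ext_expectation_defined_def nn_integral_distr)
  show "ext_expectation M (\<lambda>x. g (T x)) = ext_expectation (distr M N T) g"
    using assms by (simp add: ext_expectation_def nn_integral_distr)
qed

text \<open>Both expectations push forward: by independence the joint law of \<open>X\<close> and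
  its copy is the product of the law of \<open>X\<close> with itself. This allows a variable to be
  replaced by any other one with the same law, on another sample space.\<close>

lemma (in prob_space) R_eq_R_distr:
  assumes X: "X \<in> borel_measurable M"
    and H: "(\<lambda>x. H \<bar>x\<bar>) \<in> borel_measurable borel"
  shows "R_defined H M X \<longleftrightarrow> R_defined H (distr M borel X) (\<lambda>x. x)"
    and "R H M X = R H (distr M borel X) (\<lambda>x. x)"
proof -
  let ?D = "distr M borel X"
  let ?T = "\<lambda>(x, y). (X x, X y)"
  interpret D: prob_space ?D
    by (rule prob_space_distr) fact
  have pair: "?D \<Otimes>\<^sub>M ?D = distr (M \<Otimes>\<^sub>M M) (borel \<Otimes>\<^sub>M borel) ?T"
    by (rule pair_measure_distr) (use X D.sigma_finite_measure_axioms in auto)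
  have T: "?T \<in> measurable (M \<Otimes>\<^sub>M M) (borel \<Otimes>\<^sub>M borel)"
    using X by measurable
  have "(\<lambda>z. fst z - snd z) \<in> borel_measurable (borel \<Otimes>\<^sub>M (borel :: real measure))"
    by measurable
  from measurable_compose[OF this H]
  have g: "spread H (\<lambda>x. x) \<in> borel_measurable (borel \<Otimes>\<^sub>M borel)"
    by (simp add: spread_def case_prod_unfold)
  have comp: "spread H X = (\<lambda>z. spread H (\<lambda>x. x) (?T z))"
    by (auto simp: spread_def)
  note eqs = ext_expectation_distr[OF X, of "\<lambda>x. x", simplified]
    ext_expectation_distr[OF T g, folded comp pair]
  show "R_defined H M X \<longleftrightarrow> R_defined H ?D (\<lambda>x. x)"
    unfolding R_defined_def eqs ..
  show "R H M X = R H ?D (\<lambda>x. x)"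
    unfolding R_def eqs ..
qed

section \<open>Monotone coupling by quantile functions\<close>

lemma quantile_coupling:
  fixes X :: "'a \<Rightarrow> real" and Y :: "'b \<Rightarrow> real"
  assumes "prob_space M" "prob_space N"
    and X: "X \<in> borel_measurable M" and Y: "Y \<in> borel_measurable N"
    and dom: "stoch_dom1 M X N Y"
  obtains P :: "real measure" and U V
  where "prob_space P" "U \<in> borel_measurable P" "V \<in> borel_measurable P"
    "distr P borel U = distr M borel X" "distr P borel V = distr N borel Y"
    "\<And>\<omega>. \<omega> \<in> space P \<Longrightarrow> U \<omega> \<le> V \<omega>"
proof -
  interpret M: prob_space M by fact
  interpret N: prob_space N by fact
  interpret X: cdf_distribution "distr M borel X"
    unfolding cdf_distribution_def using X by auto
  interpret Y: cdf_distribution "distr N borel Y"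
    unfolding cdf_distribution_def using Y by auto
  \<comment> \<open>The uniform law on the open unit interval. The quantile functions
    \<open>X.I\<close> and \<open>Y.I\<close>, evaluated at the same uniform point, form the
    coupling.\<close>
  let ?P = "restrict_space lborel {0<..<1} :: real measure"
  have P: "prob_space ?P"
    by (auto simp: emeasure_restrict_space space_restrict_space intro!: prob_spaceI)
  have meas: "X.I \<in> borel_measurable ?P" "Y.I \<in> borel_measurable ?P"
    using X.measurable_CI Y.measurable_CI
    by (auto cong: measurable_cong_sets simp: sets_restrict_space)
  have cdf_le: "Y.C t \<le> X.C t" for t
  proof -
    have "X.C t = 1 - \<P>(\<omega> in M. X \<omega> > t)"
      using X by (subst M.prob_neg[symmetric])
        (auto simp: cdf_def measure_distr not_less intro!: arg_cong[where f = M.prob])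
    moreover have "Y.C t = 1 - \<P>(\<omega> in N. Y \<omega> > t)"
      using Y by (subst N.prob_neg[symmetric])
        (auto simp: cdf_def measure_distr not_less intro!: arg_cong[where f = N.prob])
    ultimately show ?thesis
      using dom by (auto simp: stoch_dom1_def)
  qed
  have le: "X.I \<omega> \<le> Y.I \<omega>" if "\<omega> \<in> space ?P" for \<omega>
  proof -
    from that have \<omega>: "0 < \<omega>" "\<omega> < 1"
      by (auto simp: space_restrict_space)
    \<comment> \<open>The Galois connection between a cdf and its quantile function turns the
      pointwise inequality of cdfs into the opposite inequality of quantiles.\<close>
    have "\<omega> \<le> Y.C (Y.I \<omega>)"
      using Y.pseudoinverse[OF \<omega>] by blast
    also have "\<dots> \<le> X.C (Y.I \<omega>)"
      by (rule cdf_le)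
    finally show ?thesis
      using X.pseudoinverse[OF \<omega>] by blast
  qed
  show thesis
    by (rule that[OF P meas X.distr_I_eq_M Y.distr_I_eq_M le])
qed

section \<open>The Lipschitz condition implies monotonicity\<close>

lemma lipschitz_abs_measurable:
  fixes H :: "real \<Rightarrow> real"
  assumes "L-lipschitz_on {0..} H"
  shows "(\<lambda>x. H \<bar>x\<bar>) \<in> borel_measurable borel"
proof -
  have "continuous_on UNIV (\<lambda>x. H \<bar>x\<bar>)"
    by (rule continuous_on_compose2[OF lipschitz_on_continuous_on[OF assms]])
      (intro continuous_intros, auto)
  then show ?thesis
    by (rule borel_measurable_continuous_onI)
qed

lemma (in pair_prob_space) distr_fst_snd:
  shows "distr (M1 \<Otimes>\<^sub>M M2) M1 fst = M1" and "distr (M1 \<Otimes>\<^sub>M M2) M2 snd = M2"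
proof -
  show "distr (M1 \<Otimes>\<^sub>M M2) M1 fst = M1"
    by (rule M2.distr_pair_fst)
  have "distr (M1 \<Otimes>\<^sub>M M2) M2 snd = distr (M2 \<Otimes>\<^sub>M M1) M2 fst"
    by (subst distr_pair_swap) (simp add: distr_distr comp_def case_prod_unfold)
  then show "distr (M1 \<Otimes>\<^sub>M M2) M2 snd = M2"
    by (simp add: M1.distr_pair_fst)
qed

lemma (in pair_prob_space) integral_fst_snd:
  fixes f :: "'a \<Rightarrow> real" and g :: "'b \<Rightarrow> real"
  shows "integrable M1 f \<Longrightarrow> integrable (M1 \<Otimes>\<^sub>M M2) (\<lambda>z. f (fst z))"
    and "integrable M1 f \<Longrightarrow> (\<integral>z. f (fst z) \<partial>(M1 \<Otimes>\<^sub>M M2)) = (\<integral>x. f x \<partial>M1)"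
    and "integrable M2 g \<Longrightarrow> integrable (M1 \<Otimes>\<^sub>M M2) (\<lambda>z. g (snd z))"
    and "integrable M2 g \<Longrightarrow> (\<integral>z. g (snd z) \<partial>(M1 \<Otimes>\<^sub>M M2)) = (\<integral>x. g x \<partial>M2)"
  using integrable_distr_eq[OF measurable_fst[of M1 M2], of f] integral_distr[OF measurable_fst[of M1 M2], of f]
    integrable_distr_eq[OF measurable_snd[of M1 M2], of g] integral_distr[OF measurable_snd[of M1 M2], of g]
  by (simp_all add: distr_fst_snd borel_measurable_integrable)

text \<open>A Lipschitz function grows at most linearly, so the spread is dominated by
  \<open>\<bar>H 0\<bar>\<close> plus a multiple of the sum of the absolute values of the two
  copies.\<close>

lemma (in prob_space) spread_integrable:
  assumes lip: "L-lipschitz_on {0..} H" and X: "integrable M X"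
  shows "integrable (M \<Otimes>\<^sub>M M) (spread H X)"
proof -
  interpret P: pair_prob_space M M ..
  let ?b = "\<lambda>z. \<bar>H 0\<bar> + L * (\<bar>X (fst z)\<bar> + \<bar>X (snd z)\<bar>)"
  have [measurable]: "X \<in> borel_measurable M"
    using X by auto
  have "(\<lambda>z. X (fst z) - X (snd z)) \<in> borel_measurable (M \<Otimes>\<^sub>M M)"
    by measurable
  from measurable_compose[OF this lipschitz_abs_measurable[OF lip]]
  have meas: "spread H X \<in> borel_measurable (M \<Otimes>\<^sub>M M)"
    by (simp add: spread_def case_prod_unfold)
  have "integrable (M \<Otimes>\<^sub>M M) ?b"
    using P.integral_fst_snd(1,3)[OF integrable_abs[OF X]]
    by (intro Bochner_Integration.integrable_add integrable_mult_right) simp_all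
  moreover have "AE z in M \<Otimes>\<^sub>M M. norm (spread H X z) \<le> norm (?b z)"
  proof (rule AE_I2)
    fix z :: "'a \<times> 'a"
    obtain x y where z: "z = (x, y)" by (cases z)
    have "dist (H \<bar>X x - X y\<bar>) (H 0) \<le> L * \<bar>X x - X y\<bar>"
      using lipschitz_onD[OF lip, of "\<bar>X x - X y\<bar>" 0] by simp
    also have "\<dots> \<le> L * (\<bar>X x\<bar> + \<bar>X y\<bar>)"
      by (intro mult_left_mono lipschitz_on_nonneg[OF lip]) auto
    finally show "norm (spread H X z) \<le> norm (?b z)"
      by (simp add: z spread_def dist_real_def)
  qed
  ultimately show ?thesis
    using meas by (blast intro: Bochner_Integration.integrable_bound)
qed

lemma (in prob_space) R_mono_coupled_integrable:
  assumes lip: "(1/2)-lipschitz_on {0..} H"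
    and U: "integrable M U" and V: "integrable M V"
    and le: "\<And>\<omega>. \<omega> \<in> space M \<Longrightarrow> U \<omega> \<le> V \<omega>"
  shows "R H M U \<le> R H M V"
proof -
  interpret P: pair_prob_space M M ..
  note int = spread_integrable[OF lip U] spread_integrable[OF lip V]
  let ?D = "\<lambda>\<omega>. (V \<omega> - U \<omega>) / 2"
  have D: "integrable M ?D"
    using U V by auto
  note D2 = P.integral_fst_snd[OF D]
  have "(\<integral>z. spread H U z - spread H V z \<partial>(M \<Otimes>\<^sub>M M))
      \<le> (\<integral>z. ?D (fst z) + ?D (snd z) \<partial>(M \<Otimes>\<^sub>M M))"
  proof (rule integral_mono)
    fix z assume "z \<in> space (M \<Otimes>\<^sub>M M)"
    then obtain x y where z: "z = (x, y)" "x \<in> space M" "y \<in> space M"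
      by (auto simp: space_pair_measure)
    have "H \<bar>U x - U y\<bar> - H \<bar>V x - V y\<bar> \<le> dist (H \<bar>U x - U y\<bar>) (H \<bar>V x - V y\<bar>)"
      by (simp add: dist_real_def)
    also have "\<dots> \<le> 1/2 * dist \<bar>U x - U y\<bar> \<bar>V x - V y\<bar>"
      by (rule lipschitz_onD[OF lip]) auto
    \<comment> \<open>The reverse triangle inequality bounds the distance by the absolute difference
      of the two increments \<open>V - U\<close>; as both are nonnegative, this is at most their
      sum.\<close>
    also have "\<dots> \<le> 1/2 * ((V x - U x) + (V y - U y))"
      using le[OF z(2)] le[OF z(3)] by (intro mult_left_mono) (auto simp: dist_real_def abs_if)
    finally show "spread H U z - spread H V z \<le> ?D (fst z) + ?D (snd z)"
      by (simp add: z(1) spread_def add_divide_distrib)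
  qed (use int D2 in auto)
  \<comment> \<open>Each copy of \<open>?D\<close> contributes half of the gain in the mean, so the
    loss in the spread term is at most the whole gain.\<close>
  also have "\<dots> = (\<integral>\<omega>. V \<omega> \<partial>M) - (\<integral>\<omega>. U \<omega> \<partial>M)"
    using D2 U V by simp
  finally show ?thesis
    using int U V by (simp add: R_def ext_expectation_integrable)
qed

lemma (in prob_space) R_mono_coupled:
  assumes lip: "(1/2)-lipschitz_on {0..} H"
    and U: "R_defined H M U" and V: "R_defined H M V"
    and le: "\<And>\<omega>. \<omega> \<in> space M \<Longrightarrow> U \<omega> \<le> V \<omega>"
  shows "R H M U \<le> R H M V"
proof -
  have pos: "(\<integral>\<^sup>+ \<omega>. ennreal (U \<omega>) \<partial>M) \<le> (\<integral>\<^sup>+ \<omega>. ennreal (V \<omega>) \<partial>M)"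
    by (intro nn_integral_mono ennreal_leI le)
  have neg: "(\<integral>\<^sup>+ \<omega>. ennreal (- V \<omega>) \<partial>M) \<le> (\<integral>\<^sup>+ \<omega>. ennreal (- U \<omega>) \<partial>M)"
    by (intro nn_integral_mono ennreal_leI) (simp add: le)
  consider "(\<integral>\<^sup>+ \<omega>. ennreal (- U \<omega>) \<partial>M) = \<infinity>" | "(\<integral>\<^sup>+ \<omega>. ennreal (V \<omega>) \<partial>M) = \<infinity>"
    | "(\<integral>\<^sup>+ \<omega>. ennreal (- U \<omega>) \<partial>M) \<noteq> \<infinity>" "(\<integral>\<^sup>+ \<omega>. ennreal (V \<omega>) \<partial>M) \<noteq> \<infinity>"
    by blast
  then show ?thesis
  proof cases
    case 1
    with U have "(\<integral>\<^sup>+ \<omega>. ennreal (U \<omega>) \<partial>M) \<noteq> \<infinity>"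
      by (auto simp: R_defined_def ext_expectation_defined_def)
    with 1 have "ext_expectation M U = - \<infinity>"
      unfolding ext_expectation_def by (cases "\<integral>\<^sup>+ \<omega>. ennreal (U \<omega>) \<partial>M") auto
    \<comment> \<open>In \<open>ereal\<close>,
      \<open>- \<infinity> + \<infinity> = \<infinity>\<close>, so \<open>R_defined\<close> is
      called upon to rule out an infinite positive expectation of the spread.\<close>
    with U have "R H M U = - \<infinity>"
      unfolding R_def R_defined_def
      by (cases "ext_expectation (M \<Otimes>\<^sub>M M) (spread H U)") auto
    then show ?thesis
      by simp
  next
    case 2
    with V have "(\<integral>\<^sup>+ \<omega>. ennreal (- V \<omega>) \<partial>M) \<noteq> \<infinity>"
      by (auto simp: R_defined_def ext_expectation_defined_def)
    with 2 have "ext_expectation M V = \<infinity>"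
      unfolding ext_expectation_def by (cases "\<integral>\<^sup>+ \<omega>. ennreal (- V \<omega>) \<partial>M") auto
    then show ?thesis
      by (simp add: R_def)
  next
    case 3
    \<comment> \<open>The order bounds the positive part of \<open>U\<close> by that of
      \<open>V\<close> and the negative part of \<open>V\<close> by that of \<open>U\<close>, so all
      four parts are finite.\<close>
    with pos neg have "(\<integral>\<^sup>+ \<omega>. ennreal (U \<omega>) \<partial>M) \<noteq> \<infinity>" "(\<integral>\<^sup>+ \<omega>. ennreal (- V \<omega>) \<partial>M) \<noteq> \<infinity>"
      by (auto simp: top_unique)
    with 3 U V have "integrable M U" "integrable M V"
      by (auto simp: real_integrable_def R_defined_def ext_expectation_defined_def)
    then show ?thesis
      using R_mono_coupled_integrable[OF lip] le by blast
  qed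
qed

text \<open>The coupling keeps both laws, hence both values of \<open>R\<close> and their
  definedness, and makes the variables comparable pointwise on one space.\<close>

lemma lipschitz_imp_R_nondecreasing:
  assumes lip: "(1/2)-lipschitz_on {0..} H"
  shows "R_nondecreasing TYPE('a) TYPE('b) H"
  unfolding R_nondecreasing_def
proof (intro allI impI)
  fix M :: "'a measure" and N :: "'b measure" and X Y
  assume M: "prob_space M" and N: "prob_space N"
    and X: "X \<in> borel_measurable M" and Y: "Y \<in> borel_measurable N"
    and dom: "stoch_dom1 M X N Y"
    and def: "R_defined H M X" "R_defined H N Y"
  obtain P :: "real measure" and U V where P: "prob_space P"
    and UV: "U \<in> borel_measurable P" "V \<in> borel_measurable P"
    and laws: "distr P borel U = distr M borel X" "distr P borel V = distr N borel Y"
    and le: "\<And>\<omega>. \<omega> \<in> space P \<Longrightarrow> U \<omega> \<le> V \<omega>"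
    using quantile_coupling[OF M N X Y dom] by blast
  note distr = prob_space.R_eq_R_distr[OF _ _ lipschitz_abs_measurable[OF lip]]
  note eqs = distr[OF M X] distr[OF N Y] distr[OF P UV(1)] distr[OF P UV(2)]
  have "R H P U \<le> R H P V"
    using def by (intro prob_space.R_mono_coupled[OF P lip _ _ le]) (simp_all add: eqs laws)
  then show "R H M X \<le> R H N Y"
    by (simp add: eqs laws)
qed

section \<open>Two-point variables and necessity of the Lipschitz condition\<close>

lemma (in prob_space) R_indicator:
  fixes a :: real
  assumes A: "A \<in> events"
  defines "X \<equiv> \<lambda>\<omega>. a * indicator A \<omega>"
  shows "R_defined H M X"
    and "R H M X = ereal (prob A * a + H 0 + 2 * prob A * (1 - prob A) * (H \<bar>a\<bar> - H 0))"
proof -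
  interpret P: pair_prob_space M M ..
  define B where "B = space M - A"
  have B: "B \<in> events" "prob B = 1 - prob A"
    using A by (auto simp: B_def prob_compl)
  \<comment> \<open>The two copies are at distance \<open>\<bar>a\<bar>\<close> when exactly one
    coordinate lies in \<open>A\<close>, and at distance 0 otherwise.\<close>
  let ?f = "\<lambda>z. H 0 + (H \<bar>a\<bar> - H 0) * (indicator (A \<times> B) z + indicator (B \<times> A) z)"
  have spread: "spread H X z = ?f z" if "z \<in> space (M \<Otimes>\<^sub>M M)" for z
    using that by (cases "fst z \<in> A"; cases "snd z \<in> A")
      (auto simp: spread_def X_def B_def space_pair_measure)
  have AB: "A \<times> B \<in> sets (M \<Otimes>\<^sub>M M)" "B \<times> A \<in> sets (M \<Otimes>\<^sub>M M)"
    using A B by auto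
  have measAB: "measure (M \<Otimes>\<^sub>M M) (A \<times> B) = prob A * prob B"
    "measure (M \<Otimes>\<^sub>M M) (B \<times> A) = prob A * prob B"
    using A B by (auto simp: measure_def emeasure_pair_measure_Times enn2real_mult)
  have f: "integrable (M \<Otimes>\<^sub>M M) ?f"
    using AB by (auto simp: P.emeasure_eq_measure)
  then have S: "integrable (M \<Otimes>\<^sub>M M) (spread H X)"
    using spread by (simp cong: Bochner_Integration.integrable_cong)
  have "(\<integral>z. spread H X z \<partial>(M \<Otimes>\<^sub>M M)) = (\<integral>z. ?f z \<partial>(M \<Otimes>\<^sub>M M))"
    using spread by (rule Bochner_Integration.integral_cong[OF refl])
  also have "\<dots> = H 0 + (H \<bar>a\<bar> - H 0) * (measure (M \<Otimes>\<^sub>M M) (A \<times> B) + measure (M \<Otimes>\<^sub>M M) (B \<times> A))"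
    using AB by (simp add: P.emeasure_eq_measure P.prob_space sets.Int_space_eq2)
  also have "\<dots> = H 0 + 2 * prob A * (1 - prob A) * (H \<bar>a\<bar> - H 0)"
    by (simp add: measAB B)
  finally have ES: "(\<integral>z. spread H X z \<partial>(M \<Otimes>\<^sub>M M)) = H 0 + 2 * prob A * (1 - prob A) * (H \<bar>a\<bar> - H 0)" .
  have X: "integrable M X"
    using A by (simp add: X_def emeasure_eq_measure)
  have EX: "(\<integral>\<omega>. X \<omega> \<partial>M) = prob A * a"
    using A by (simp add: X_def)
  note ext = ext_expectation_integrable[OF X] ext_expectation_integrable[OF S]
  show "R_defined H M X"
    by (simp add: R_defined_def ext)
  show "R H M X = ereal (prob A * a + H 0 + 2 * prob A * (1 - prob A) * (H \<bar>a\<bar> - H 0))"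
    by (simp add: R_def ext EX ES)
qed

lemma exists_real_prob_space_event:
  assumes "0 \<le> p" "p \<le> 1"
  obtains M :: "real measure" and A where "prob_space M" "A \<in> sets M" "measure M A = p"
proof
  \<comment> \<open>A Bernoulli law carried over to the reals, so that the sample space has the type
    fixed in the monotonicity hypothesis.\<close>
  let ?M = "measure_pmf (map_pmf of_bool (bernoulli_pmf p)) :: real measure"
  show "prob_space ?M"
    by (rule prob_space_measure_pmf)
  have "(of_bool :: bool \<Rightarrow> real) -` {1} = {True}"
    by auto
  then show "measure ?M {1} = p"
    using assms unfolding measure_map_pmf by (simp add: measure_pmf_single)
qed simp

text \<open>Compare \<open>a\<close> and \<open>b\<close> times the indicator of one event of
  probability \<open>p\<close>. The terms in \<open>H 0\<close> cancel, and the common factor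
  \<open>p\<close> can be divided out.\<close>

lemma R_nondecreasing_imp_difference:
  fixes a b p :: real
  assumes R: "R_nondecreasing TYPE(real) TYPE(real) H"
    and "a \<le> b" and p: "0 < p" "p < 1"
  shows "2 * (1 - p) * (H \<bar>a\<bar> - H \<bar>b\<bar>) \<le> b - a"
proof -
  obtain M :: "real measure" and A where M: "prob_space M" and A: "A \<in> sets M" "measure M A = p"
    using exists_real_prob_space_event[of p] p by auto
  interpret prob_space M by fact
  let ?X = "\<lambda>c \<omega>. c * indicator A \<omega> :: real"
  have meas: "?X c \<in> borel_measurable M" for c
    using A by measurable
  have "?X a \<omega> \<le> ?X b \<omega>" for \<omega>
    using \<open>a \<le> b\<close> by (simp add: indicator_def)
  then have "stoch_dom1 M (?X a) M (?X b)"
    unfolding stoch_dom1_def using meas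
    by (intro allI finite_measure_mono) (auto intro: less_le_trans)
  then have "R H M (?X a) \<le> R H M (?X b)"
    using R M meas R_indicator(1)[OF A(1)] unfolding R_nondecreasing_def by blast
  then have "p * a + 2 * p * (1 - p) * (H \<bar>a\<bar> - H 0) \<le> p * b + 2 * p * (1 - p) * (H \<bar>b\<bar> - H 0)"
    by (simp add: R_indicator(2)[OF A(1)] A(2))
  then have "p * (2 * (1 - p) * (H \<bar>a\<bar> - H \<bar>b\<bar>)) \<le> p * (b - a)"
    by (simp add: algebra_simps)
  with p show ?thesis
    by simp
qed

lemma R_nondecreasing_imp_lipschitz:
  assumes R: "R_nondecreasing TYPE(real) TYPE(real) H"
  shows "(1/2)-lipschitz_on {0..} H"
proof -
  have diff: "H \<bar>a\<bar> - H \<bar>b\<bar> \<le> (b - a) / 2" if "a \<le> b" for a b :: real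
  proof -
    \<comment> \<open>As \<open>p\<close> tends to 0 from the right, the factor \<open>1 - p\<close>
      tends to 1, which leaves exactly the constant 1/2.\<close>
    have "((\<lambda>p. 2 * (1 - p) * (H \<bar>a\<bar> - H \<bar>b\<bar>)) \<longlongrightarrow> 2 * (1 - 0) * (H \<bar>a\<bar> - H \<bar>b\<bar>)) (at_right 0)"
      by (intro tendsto_intros)
    moreover have "\<forall>\<^sub>F p in at_right 0. 2 * (1 - p) * (H \<bar>a\<bar> - H \<bar>b\<bar>) \<le> b - a"
      by (rule eventually_mono[OF eventually_at_right_real[of 0 1]])
        (simp_all add: R_nondecreasing_imp_difference[OF R that] del: right_diff_distrib_numeral)
    ultimately have "2 * (1 - 0) * (H \<bar>a\<bar> - H \<bar>b\<bar>) \<le> b - a"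
      by (rule tendsto_upperbound) simp
    then show ?thesis
      by simp
  qed
  have ordered: "\<bar>H x - H y\<bar> \<le> (y - x) / 2" if "0 \<le> x" "x \<le> y" for x y
    \<comment> \<open>The pair \<open>x\<close>, \<open>y\<close> bounds \<open>H x - H y\<close>.
      The reflected pair \<open>- y\<close>, \<open>- x\<close> has the same absolute values in the
      opposite order and bounds \<open>H y - H x\<close>.\<close>
    using diff[of x y] diff[of "- y" "- x"] that by (simp add: abs_le_iff) argo
  have "\<bar>H x - H y\<bar> \<le> \<bar>x - y\<bar> / 2" if "0 \<le> x" "0 \<le> y" for x y
    using ordered[of x y] ordered[of y x] that by (cases "x \<le> y") (simp_all add: abs_minus_commute)
  then show ?thesis
    by (intro lipschitz_onI) (simp_all add: dist_real_def)
qed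

theorem proposition4p2:
  fixes H :: "real \<Rightarrow> real"
  assumes "H \<in> borel_measurable (restrict_space borel {0..})"
  shows "(R_nondecreasing TYPE(real) TYPE(real) H \<longleftrightarrow> (1/2)-lipschitz_on {0..} H) \<and>
         ((1/2)-lipschitz_on {0..} H \<longrightarrow> R_nondecreasing TYPE('a) TYPE('b) H)"
  by (intro conjI iffI impI)
    (erule R_nondecreasing_imp_lipschitz lipschitz_imp_R_nondecreasing)+

end
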